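(* Let $\mathcal C\subset\mathbb{P}^{n-1}$ be a real polyhedral cone. Then there exist a subset $\mathcal A\subset\mathcal C$ and, for each $a\in\mathcal A$, a collection $\mathcal C_a$ of pairwise disjoint sets of tropical half-spaces with apex $a$, with the following property: a finite set $\Gamma$ of tropical half-spaces whose apices belong to $\mathcal C$ is a non-redundant external representation of $\mathcal C$ if and only if $\Gamma$ consists of precisely one half-space from each set of the collection $\mathcal C_a$, for each $a\in\mathcal A$.
   Context: Work in the max-plus semiring $\mathbb{R}_{\max}=\mathbb{R}\cup\{-\infty\}$ with addition $x\oplus y=\max(x,y)$ and multiplication $x\otimes y=x+y$; on $\mathbb{R}_{\max}^n$ addition is componentwise maximum and $\lambda x=(\lambda+x_1,\dots,\lambda+x_n)$. A real polyhedral cone is a set of the form $\mathcal C=\{\lambda_1v^1\oplus\dots\oplus\lambda_pv^p:\lambda_r\in\mathbb{R}_{\max}\}$ with $v^1,\dots,v^p\in\mathbb{R}^n$, identified with its image in the projective space $\mathbb{P}^{n-1}=\mathbb{R}^n/\mathbb{R}(1,\dots,1)$. For $a\in\mathbb{R}^n$ and a non-empty proper subset $I\subsetneq[n]=\{1,\dots,n\}$, the tropical half-space with apex $a$ and sectors $I$ is $\mathcal H(a,I)=\{x\in\mathbb{R}_{\max}^n\setminus\{(-\infty,\dots,-\infty)\}:\max_{i\in I}(x_i-a_i)\ge\max_{j\notin I}(x_j-a_j)\}$, considered modulo adding constants to all coordinates; its apex (an element of $\mathbb{P}^{n-1}$) and its set of sectors are uniquely determined by the set. Here "tropical half-space" always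 means a set of this form. A finite set $\Gamma$ of such half-spaces, each containing $\mathcal C$, is a non-redundant external representation of $\mathcal C$ if $\bigcap_{\mathcal H\in\Gamma}\mathcal H=\mathcal C$ and for every $\mathcal H\in\Gamma$ the intersection of the half-spaces in $\Gamma\setminus\{\mathcal H\}$ is not contained in $\mathcal H$. *)

theory Defs
  imports "HOL-Analysis.Analysis" "HOL-Library.Disjoint_Sets"
begin

text \<open>The max-plus semiring is represented by the extended reals other than \<open>\<infinity>\<close>: the tropical
  sum is \<open>max\<close>, the tropical product is \<open>+\<close>. The set below consists of the vectors
  with entries in the max-plus semiring, not all of them \<open>-\<infinity>\<close>.\<close>

definition rmax_vectors :: "(ereal ^ 'n::finite) set" where
  "rmax_vectors = {x. (\<forall>i. x $ i \<noteq> \<infinity>) \<and> (\<exists>i. x $ i \<noteq> - \<infinity>)}"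

definition proj_rel :: "ereal ^ 'n::finite \<Rightarrow> ereal ^ 'n \<Rightarrow> bool" where
  "proj_rel x y \<longleftrightarrow> x \<in> rmax_vectors \<and> y \<in> rmax_vectors \<and>
     (\<exists>c::real. \<forall>i. y $ i = ereal c + x $ i)"

text \<open>The projective space over the max-plus semiring. It contains the projective space
  of real vectors modulo multiples of \<open>(1, \<dots>, 1)\<close> as the range of \<open>real_point\<close>.\<close>

quotient_type (overloaded) 'n tproj = "ereal ^ 'n::finite" / partial: proj_rel
  morphisms rep_tproj point
proof (rule part_equivpI)
  show "\<exists>x::ereal ^ 'n. proj_rel x x"
    by (rule exI[of _ "\<chi> i. 0"]) (auto simp: proj_rel_def rmax_vectors_def intro!: exI[of _ 0])
  show "symp (proj_rel :: ereal ^ 'n \<Rightarrow> _)"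
  proof (rule sympI)
    fix x y :: "ereal ^ 'n"
    assume "proj_rel x y"
    then obtain c :: real where xy: "x \<in> rmax_vectors" "y \<in> rmax_vectors"
      and c: "\<And>i. y $ i = ereal c + x $ i"
      by (auto simp: proj_rel_def)
    have "x $ i = ereal (- c) + y $ i" for i
      by (cases "x $ i") (auto simp: c)
    with xy show "proj_rel y x"
      unfolding proj_rel_def by blast
  qed
  show "transp (proj_rel :: ereal ^ 'n \<Rightarrow> _)"
  proof (rule transpI)
    fix x y z :: "ereal ^ 'n"
    assume "proj_rel x y" "proj_rel y z"
    then obtain c d :: real where xz: "x \<in> rmax_vectors" "z \<in> rmax_vectors"
      and c: "\<And>i. y $ i = ereal c + x $ i" and d: "\<And>i. z $ i = ereal d + y $ i"
      by (auto simp: proj_rel_def)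
    have "z $ i = ereal (d + c) + x $ i" for i
      by (cases "x $ i") (auto simp: c d)
    with xz show "proj_rel x z"
      unfolding proj_rel_def by blast
  qed
qed

definition real_point :: "real ^ 'n::finite \<Rightarrow> 'n tproj" where
  "real_point a = point (\<chi> i. ereal (a $ i))"

text \<open>All tropical linear combinations of the real vectors \<open>v 1, \<dots>, v p\<close>.\<close>

definition tropical_cone :: "nat \<Rightarrow> (nat \<Rightarrow> real ^ 'n::finite) \<Rightarrow> (ereal ^ 'n) set" where
  "tropical_cone p v =
     {\<chi> i. (MAX r\<in>{1..p}. l r + ereal (v r $ i)) | l :: nat \<Rightarrow> ereal. \<forall>r\<in>{1..p}. l r \<noteq> \<infinity>}"

text \<open>The intersection with \<open>rmax_vectors\<close> only discards the vector \<open>(-\<infinity>, \<dots>, -\<infinity>)\<close>, which has no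
  image in projective space.\<close>

definition real_polyhedral_cone :: "'n::finite tproj set \<Rightarrow> bool" where
  "real_polyhedral_cone C \<longleftrightarrow>
     (\<exists>p v. p \<ge> 1 \<and> C = point ` (tropical_cone p v \<inter> rmax_vectors))"

definition half_space :: "real ^ 'n::finite \<Rightarrow> 'n set \<Rightarrow> 'n tproj set" where
  "half_space a I = point ` {x \<in> rmax_vectors.
     (MAX i\<in>I. x $ i - ereal (a $ i)) \<ge> (MAX j\<in>- I. x $ j - ereal (a $ j))}"

definition half_spaces_with_apex :: "'n::finite tproj \<Rightarrow> 'n tproj set set" where
  "half_spaces_with_apex \<alpha> =
     {half_space a I | a I. real_point a = \<alpha> \<and> I \<noteq> {} \<and> I \<noteq> UNIV}"

definition half_spaces :: "'n::finite tproj set set" where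
  "half_spaces = {half_space a I | a I. I \<noteq> {} \<and> I \<noteq> UNIV}"

definition nonredundant_external_representation ::
  "'n::finite tproj set \<Rightarrow> 'n tproj set set \<Rightarrow> bool" where
  "nonredundant_external_representation C \<Gamma> \<longleftrightarrow>
     finite \<Gamma> \<and> \<Gamma> \<subseteq> half_spaces \<and> (\<forall>H\<in>\<Gamma>. C \<subseteq> H) \<and>
     \<Inter>\<Gamma> = C \<and> (\<forall>H\<in>\<Gamma>. \<not> \<Inter>(\<Gamma> - {H}) \<subseteq> H)"

text \<open>\<open>\<Gamma>\<close> consists of precisely one element of each set in each of the collections \<open>K a\<close>, where
  \<open>a\<close> ranges over \<open>A\<close>.\<close>

definition one_from_each :: "'a set \<Rightarrow> ('a \<Rightarrow> 'b set set) \<Rightarrow> 'b set \<Rightarrow> bool" where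
  "one_from_each A K \<Gamma> \<longleftrightarrow>
     \<Gamma> \<subseteq> (\<Union>a\<in>A. \<Union>(K a)) \<and> (\<forall>a\<in>A. \<forall>S\<in>K a. \<exists>!H. H \<in> \<Gamma> \<and> H \<in> S)"

end

theory Submission
  imports Defs
begin

text \<open>Consider the half-spaces that contain \<open>C\<close> and have their apex in \<open>C\<close>, with the closure operator
  sending a set \<open>\<Delta>\<close> to the half-spaces that contain \<open>\<Inter>\<Delta>\<close>. Two properties of this operator suffice.
  First, half-spaces that can be exchanged for each other over some \<open>\<Delta>\<close> have the same apex. Second,
  if half-spaces with apex \<open>a\<close> imply, together with \<open>\<Delta>\<close>, another one with apex \<open>a\<close>, then a single one
  of them does: the sum of suitably scaled witnesses against each of them is a witness against all
  of them. Fix a non-redundant representation \<open>\<Gamma>\<close> with apices in \<open>C\<close>, if there is one. The class of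
  \<open>H \<in> \<Gamma>\<close> consists of the half-spaces with the same apex that are equivalent to \<open>H\<close> over the elements
  of \<open>\<Gamma>\<close> with other apices, and the non-redundant representations are the transversals of these
  classes.\<close>

section \<open>Closure systems with anti-exchange between different apices\<close>

locale partial_anti_exchange =
  fixes F :: "'p set set" and apex :: "'p set \<Rightarrow> 'b"
  assumes anti_exchange:
    "\<lbrakk>\<Delta> \<subseteq> F; H \<in> F; G \<in> F; \<not> \<Inter>\<Delta> \<subseteq> H; \<Inter>(insert G \<Delta>) \<subseteq> H; \<Inter>(insert H \<Delta>) \<subseteq> G\<rbrakk>
      \<Longrightarrow> apex H = apex G"
  and single_premise:
    "\<lbrakk>\<Delta> \<subseteq> F; \<Lambda> \<subseteq> F; finite \<Lambda>; \<Lambda> \<noteq> {}; G \<in> F; \<And>L. L \<in> \<Lambda> \<Longrightarrow> apex L = apex G; \<Inter>(\<Delta> \<union> \<Lambda>) \<subseteq> G\<rbrakk>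
      \<Longrightarrow> \<exists>L\<in>\<Lambda>. \<Inter>(insert L \<Delta>) \<subseteq> G"
begin

text \<open>These are the minimal finite generating sets of \<open>F\<close> for the closure
  operator. Generation is measured against \<open>F\<close> alone, so that no target set has to be
  fixed.\<close>

definition basis :: "'p set set \<Rightarrow> bool" where
  "basis \<Gamma> \<longleftrightarrow> finite \<Gamma> \<and> \<Gamma> \<subseteq> F \<and> (\<forall>H\<in>F. \<Inter>\<Gamma> \<subseteq> H) \<and> (\<forall>H\<in>\<Gamma>. \<not> \<Inter>(\<Gamma> - {H}) \<subseteq> H)"

definition off_apex :: "'p set set \<Rightarrow> 'b \<Rightarrow> 'p set set" where
  "off_apex \<Gamma> a = {H \<in> \<Gamma>. apex H \<noteq> a}"

definition equivalent_over :: "'p set set \<Rightarrow> 'p set \<Rightarrow> 'p set \<Rightarrow> bool" where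
  "equivalent_over \<Delta> H G \<longleftrightarrow> \<Inter>\<Delta> \<inter> H = \<Inter>\<Delta> \<inter> G"

definition exchange_class :: "'p set set \<Rightarrow> 'p set \<Rightarrow> 'p set set" where
  "exchange_class \<Gamma> H =
     {G \<in> F. apex G = apex H \<and> equivalent_over (off_apex \<Gamma> (apex H)) G H}"

definition exchange_classes :: "'p set set \<Rightarrow> 'b \<Rightarrow> 'p set set set" where
  "exchange_classes \<Gamma> a = exchange_class \<Gamma> ` {H \<in> \<Gamma>. apex H = a}"

lemma basisD:
  assumes "basis \<Gamma>"
  shows "finite \<Gamma>" "\<Gamma> \<subseteq> F" "\<And>H. H \<in> F \<Longrightarrow> \<Inter>\<Gamma> \<subseteq> H" "\<And>H. H \<in> \<Gamma> \<Longrightarrow> \<not> \<Inter>(\<Gamma> - {H}) \<subseteq> H"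
  using assms by (auto simp: basis_def)

text \<open>Add the members of \<open>X\<close> one at a time. If adding \<open>G\<close> made
  \<open>H\<close> implied, then \<open>G\<close> and \<open>H\<close> would be exchangeable over
  what is already there, because \<open>B\<close> together with \<open>H\<close> generates
  \<open>F\<close>; anti-exchange would give them the same apex.\<close>

lemma not_implied_by_other_apices:
  assumes "finite X" "X \<subseteq> F" "B \<subseteq> F" "H \<in> F"
    and gen: "\<And>G. G \<in> F \<Longrightarrow> \<Inter>(insert H B) \<subseteq> G"
    and "\<not> \<Inter>B \<subseteq> H" "\<And>G. G \<in> X \<Longrightarrow> apex G \<noteq> apex H"
  shows "\<not> \<Inter>(B \<union> X) \<subseteq> H"
  using assms(1,2,7)
proof (induction X rule: finite_induct)
  case empty
  then show ?case using assms by simp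
next
  case (insert G X)
  have "\<Inter>(insert H (B \<union> X)) \<subseteq> G"
    using gen[of G] insert.prems by auto
  moreover have "\<not> \<Inter>(B \<union> X) \<subseteq> H"
    using insert by auto
  moreover have "G \<in> F" "B \<union> X \<subseteq> F" "apex G \<noteq> apex H"
    using insert.prems assms(3) by auto
  ultimately show ?case
    using anti_exchange[of "B \<union> X" H G] assms(4) by (metis Un_insert_right)
qed

lemma basis_irredundant:
  assumes "basis \<Gamma>" "H \<in> \<Gamma>" "finite X" "X \<subseteq> F" "\<And>G. G \<in> X \<Longrightarrow> apex G \<noteq> apex H"
  shows "\<not> \<Inter>(\<Gamma> - {H} \<union> X) \<subseteq> H"
proof (rule not_implied_by_other_apices)
  show "\<Inter>(insert H (\<Gamma> - {H})) \<subseteq> G" if "G \<in> F" for G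
    using basisD(3)[OF assms(1) that] assms(2) by (auto simp: insert_absorb)
qed (use assms basisD[OF assms(1)] in auto)

text \<open>If \<open>L\<close> differed from \<open>H\<close>, it would survive in
  \<open>\<Gamma> - {H}\<close> along with all members having other apices, so
  \<open>\<Gamma> - {H}\<close> and \<open>X\<close> would imply \<open>H\<close>, against
  \<open>basis_irredundant\<close>. Used to close round trips between two bases.\<close>

lemma basis_element_unique:
  assumes \<Gamma>: "basis \<Gamma>" and H: "H \<in> \<Gamma>" and "L \<in> \<Gamma>" "apex L = apex H" "finite X" "X \<subseteq> F"
    "\<And>G. G \<in> X \<Longrightarrow> apex G \<noteq> apex H"
    and le: "\<Inter>(off_apex \<Gamma> (apex H) \<union> X) \<inter> L \<subseteq> H"
  shows "L = H"
proof (rule ccontr)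
  assume "L \<noteq> H"
  then have "\<Inter>(\<Gamma> - {H} \<union> X) \<subseteq> \<Inter>(off_apex \<Gamma> (apex H) \<union> X) \<inter> L"
    using assms(3) by (auto simp: off_apex_def)
  with le basis_irredundant[OF \<Gamma> H assms(5-7)] show False by blast
qed

text \<open>Split \<open>\<Gamma>\<close> by whether the apex is that of \<open>H\<close>, and apply
  \<open>single_premise\<close> to the non-empty part sharing it.\<close>

lemma implied_by_one:
  assumes \<Gamma>: "basis \<Gamma>" and "H \<in> F" "apex H \<in> apex ` \<Gamma>"
  obtains L where "L \<in> \<Gamma>" "apex L = apex H" "\<Inter>(off_apex \<Gamma> (apex H)) \<inter> L \<subseteq> H"
proof -
  let ?\<Lambda> = "{L \<in> \<Gamma>. apex L = apex H}"
  have "off_apex \<Gamma> (apex H) \<union> ?\<Lambda> = \<Gamma>"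
    by (auto simp: off_apex_def)
  then have "\<exists>L\<in>?\<Lambda>. \<Inter>(insert L (off_apex \<Gamma> (apex H))) \<subseteq> H"
    using assms basisD[OF \<Gamma>] by (intro single_premise) (auto simp: off_apex_def)
  then show ?thesis
    using that by auto
qed

text \<open>This lets equivalences be transported from one basis to another. The member of
  \<open>\<Gamma>\<close> that implies \<open>G\<close> must be \<open>H\<close> itself, by
  uniqueness. Conversely, if \<open>G\<close> did not imply \<open>H\<close> over \<open>?D\<close>,
  then \<open>single_premise\<close> shows that \<open>G\<close> with the rest of
  \<open>\<Gamma>\<close> does not either, and enlarging by \<open>X\<close>, whose apices differ,
  cannot change that.\<close>

lemma equivalent_over_restrict:
  assumes \<Gamma>: "basis \<Gamma>" and H: "H \<in> \<Gamma>" and G: "G \<in> F" "apex G = apex H"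
    and X: "finite X" "X \<subseteq> F" "\<And>K. K \<in> X \<Longrightarrow> apex K \<noteq> apex H"
    and eq: "equivalent_over (off_apex \<Gamma> (apex H) \<union> X) G H"
  shows "equivalent_over (off_apex \<Gamma> (apex H)) G H"
proof -
  let ?D = "off_apex \<Gamma> (apex H)"
  have "apex G \<in> apex ` \<Gamma>"
    using H G by simp
  from implied_by_one[OF \<Gamma> G(1) this] obtain L where
    L: "L \<in> \<Gamma>" "apex L = apex H" "\<Inter>?D \<inter> L \<subseteq> G"
    using G by auto
  then have "\<Inter>(?D \<union> X) \<inter> L \<subseteq> H"
    using eq by (auto simp: equivalent_over_def)
  with L have "L = H"
    using basis_element_unique[OF \<Gamma> H, of L X] X by blast
  with L have 1: "\<Inter>?D \<inter> H \<subseteq> G" by simp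
  have 2: "\<Inter>?D \<inter> G \<subseteq> H"
  proof (rule ccontr)
    assume *: "\<not> \<Inter>?D \<inter> G \<subseteq> H"
    have "\<not> \<Inter>(insert G (\<Gamma> - {H})) \<subseteq> H"
    proof
      assume imp: "\<Inter>(insert G (\<Gamma> - {H})) \<subseteq> H"
      let ?\<Lambda> = "insert G {L \<in> \<Gamma> - {H}. apex L = apex H}"
      have "?D \<union> ?\<Lambda> = insert G (\<Gamma> - {H})"
        by (auto simp: off_apex_def)
      then have "\<exists>L\<in>?\<Lambda>. \<Inter>(insert L ?D) \<subseteq> H"
        using imp basisD[OF \<Gamma>] G H by (intro single_premise) (auto simp: off_apex_def)
      then obtain L where L: "L \<in> ?\<Lambda>" "\<Inter>?D \<inter> L \<subseteq> H" by auto
      with * have "L \<in> \<Gamma>" "L \<noteq> H" "apex L = apex H" by auto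
      with basis_element_unique[OF \<Gamma> H, of L "{}"] L show False by auto
    qed
    then have "\<not> \<Inter>(insert G (\<Gamma> - {H}) \<union> X) \<subseteq> H"
    proof (rule not_implied_by_other_apices[rotated 5])
      show "\<Inter>(insert H (insert G (\<Gamma> - {H}))) \<subseteq> K" if "K \<in> F" for K
        using basisD(3)[OF \<Gamma> that] by auto
    qed (use X G H basisD[OF \<Gamma>] in auto)
    moreover have "\<Inter>(insert G (\<Gamma> - {H}) \<union> X) \<subseteq> \<Inter>(?D \<union> X) \<inter> G"
      by (auto simp: off_apex_def)
    ultimately show False
      using eq by (auto simp: equivalent_over_def)
  qed
  from 1 2 show ?thesis by (auto simp: equivalent_over_def)
qed

section \<open>Comparing two bases and exchanging their elements\<close>

text \<open>Otherwise all of \<open>\<Gamma>'\<close> could be added to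
  \<open>\<Gamma> - {H}\<close> without implying \<open>H\<close>, although \<open>\<Gamma>'\<close>
  generates \<open>H\<close>.\<close>

lemma basis_apex_mem:
  assumes \<Gamma>: "basis \<Gamma>" and \<Gamma>': "basis \<Gamma>'" and H: "H \<in> \<Gamma>"
  shows "apex H \<in> apex ` \<Gamma>'"
proof (rule ccontr)
  assume "apex H \<notin> apex ` \<Gamma>'"
  then have "apex G \<noteq> apex H" if "G \<in> \<Gamma>'" for G
    using that by (metis imageI)
  with basis_irredundant[OF \<Gamma> H basisD(1,2)[OF \<Gamma>']]
  have "\<not> \<Inter>(\<Gamma> - {H} \<union> \<Gamma>') \<subseteq> H" by blast
  moreover have "\<Inter>\<Gamma>' \<subseteq> H"
    using basisD(2)[OF \<Gamma>] basisD(3)[OF \<Gamma>'] H by blast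
  ultimately show False by blast
qed

text \<open>A round trip: some \<open>H'\<close> in \<open>\<Gamma>'\<close> implies
  \<open>H\<close>, and some \<open>L\<close> in \<open>\<Gamma>\<close> implies \<open>H'\<close>,
  each over the other apices of its basis. Composing them forces \<open>L = H\<close>, so
  \<open>H\<close> and \<open>H'\<close> are equivalent over the other apices of both bases, and
  \<open>equivalent_over_restrict\<close> removes those of \<open>\<Gamma>\<close>.\<close>

lemma basis_in_exchange_class:
  assumes \<Gamma>: "basis \<Gamma>" and \<Gamma>': "basis \<Gamma>'" and H: "H \<in> \<Gamma>"
  obtains H' where "H' \<in> \<Gamma>'" "H \<in> exchange_class \<Gamma>' H'"
proof -
  let ?a = "apex H"
  let ?D = "off_apex \<Gamma> ?a" and ?D' = "off_apex \<Gamma>' ?a"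
  have HF: "H \<in> F" using basisD(2)[OF \<Gamma>] H by auto
  obtain H' where H': "H' \<in> \<Gamma>'" "apex H' = ?a" "\<Inter>?D' \<inter> H' \<subseteq> H"
    using implied_by_one[OF \<Gamma>' HF basis_apex_mem[OF assms]] by blast
  have H'F: "H' \<in> F" using basisD(2)[OF \<Gamma>'] H' by auto
  obtain L where L: "L \<in> \<Gamma>" "apex L = ?a" "\<Inter>?D \<inter> L \<subseteq> H'"
    using implied_by_one[OF \<Gamma> H'F] H H' by (metis imageI)
  have D: "finite ?D" "?D \<subseteq> F" "\<And>G. G \<in> ?D \<Longrightarrow> apex G \<noteq> ?a"
    and D': "finite ?D'" "?D' \<subseteq> F" "\<And>G. G \<in> ?D' \<Longrightarrow> apex G \<noteq> ?a"
    using basisD(1,2)[OF \<Gamma>] basisD(1,2)[OF \<Gamma>'] by (auto simp: off_apex_def)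
  have "\<Inter>(?D \<union> ?D') \<inter> L \<subseteq> H"
    using L H' by auto
  then have "L = H"
    using basis_element_unique[OF \<Gamma> H L(1,2) D'] by blast
  then have "equivalent_over (?D' \<union> ?D) H H'"
    using L H' by (auto simp: equivalent_over_def)
  then have "equivalent_over ?D' H H'"
    using equivalent_over_restrict[OF \<Gamma>' H'(1) HF, of ?D] H' D by auto
  then show ?thesis
    using that H' HF by (auto simp: exchange_class_def)
qed

lemma basis_exchange_class_unique:
  assumes \<Gamma>: "basis \<Gamma>" and \<Gamma>': "basis \<Gamma>'" and H: "H \<in> \<Gamma>" "G \<in> \<Gamma>"
    and mem: "H \<in> exchange_class \<Gamma>' H'" "G \<in> exchange_class \<Gamma>' H'"
  shows "G = H"
proof -
  have a: "apex G = apex H" "apex H' = apex H"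
    using mem by (auto simp: exchange_class_def)
  have "\<Inter>(off_apex \<Gamma> (apex H) \<union> off_apex \<Gamma>' (apex H)) \<inter> G \<subseteq> H"
    using mem a by (auto simp: exchange_class_def equivalent_over_def)
  then show ?thesis
    using basisD(1,2)[OF \<Gamma>'] a
    by (intro basis_element_unique[OF \<Gamma> H(1), of _ "off_apex \<Gamma>' (apex H)"] H(2))
      (auto simp: off_apex_def)
qed

text \<open>A common element \<open>K\<close> makes \<open>G\<close> and \<open>H\<close> equivalent
  to each other, which reduces the claim to the previous lemma with both bases equal.\<close>

lemma exchange_classes_disjoint:
  assumes \<Gamma>: "basis \<Gamma>" and H: "H \<in> \<Gamma>" "G \<in> \<Gamma>"
    and mem: "K \<in> exchange_class \<Gamma> H" "K \<in> exchange_class \<Gamma> G"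
  shows "G = H"
proof -
  have "G \<in> exchange_class \<Gamma> H"
    using H basisD(2)[OF \<Gamma>] mem by (auto simp: exchange_class_def equivalent_over_def)
  moreover have "H \<in> exchange_class \<Gamma> H"
    using H basisD(2)[OF \<Gamma>] by (auto simp: exchange_class_def equivalent_over_def)
  ultimately show ?thesis
    using basis_exchange_class_unique[OF \<Gamma> \<Gamma> H] by blast
qed

lemma exchange_class_implied:
  assumes G: "G \<in> exchange_class \<Gamma> H"
  shows "\<Inter>(insert G (\<Gamma> - {H})) \<subseteq> H"
proof -
  have "off_apex \<Gamma> (apex H) \<subseteq> \<Gamma> - {H}"
    by (auto simp: off_apex_def)
  then have "\<Inter>(insert G (\<Gamma> - {H})) \<subseteq> \<Inter>(off_apex \<Gamma> (apex H)) \<inter> G"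
    by blast
  moreover have "\<Inter>(off_apex \<Gamma> (apex H)) \<inter> G \<subseteq> H"
    using G by (auto simp: exchange_class_def equivalent_over_def)
  ultimately show ?thesis by (rule order_trans)
qed

text \<open>Generation holds because \<open>G\<close> gives \<open>H\<close> back. For minimality, a
  redundant \<open>K\<close> other than \<open>G\<close> would be exchangeable with \<open>G\<close>
  over \<open>\<Gamma> - {K}\<close>, hence share its apex. Then \<open>\<Gamma> - {K}\<close>
  contains \<open>H\<close> and all members with other apices, so it already implies
  \<open>G\<close>, and therefore \<open>K\<close>.\<close>

lemma basis_replace:
  assumes \<Gamma>: "basis \<Gamma>" and H: "H \<in> \<Gamma>" and G: "G \<in> exchange_class \<Gamma> H"
  shows "basis (insert G (\<Gamma> - {H}))"
proof -
  note B = basisD[OF \<Gamma>]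
  have GF: "G \<in> F" and aG: "apex G = apex H"
    and eq: "\<Inter>(off_apex \<Gamma> (apex H)) \<inter> G = \<Inter>(off_apex \<Gamma> (apex H)) \<inter> H"
    using G by (auto simp: exchange_class_def equivalent_over_def)
  have le: "\<Inter>(insert G (\<Gamma> - {H})) \<subseteq> \<Inter>\<Gamma>"
    using exchange_class_implied[OF G] by blast
  have "\<not> \<Inter>(insert G (\<Gamma> - {H}) - {K}) \<subseteq> K" if K: "K \<in> insert G (\<Gamma> - {H})" for K
  proof
    assume imp: "\<Inter>(insert G (\<Gamma> - {H}) - {K}) \<subseteq> K"
    show False
    proof (cases "K = G")
      case True
      then have "\<Inter>(\<Gamma> - {H}) \<subseteq> H"
        using imp le H by auto
      then show False using B(4)[OF H] by blast
    next
      case False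
      with K have K': "K \<in> \<Gamma>" "K \<noteq> H" by auto
      then have KF: "K \<in> F" using B by auto
      let ?\<Delta> = "\<Gamma> - {K}"
      have nK: "\<not> \<Inter>?\<Delta> \<subseteq> K" using B(4) K' by blast
      have "\<Inter>(insert G ?\<Delta>) \<subseteq> K"
        using imp by auto
      moreover have "\<Inter>(insert K ?\<Delta>) \<subseteq> G"
        using B(3)[OF GF] by auto
      ultimately have "apex K = apex G"
        using B(2) by (intro anti_exchange[OF _ KF GF nK]) auto
      then have "\<Inter>?\<Delta> \<subseteq> \<Inter>(off_apex \<Gamma> (apex H)) \<inter> H"
        using H K' aG by (auto simp: off_apex_def)
      then have "\<Inter>?\<Delta> \<subseteq> G" using eq by blast
      with \<open>\<Inter>(insert G ?\<Delta>) \<subseteq> K\<close> nK show False by auto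
    qed
  qed
  moreover have "\<Inter>(insert G (\<Gamma> - {H})) \<subseteq> K" if "K \<in> F" for K
    using le B(3)[OF that] by (rule order_trans)
  moreover have "finite (insert G (\<Gamma> - {H}))" "insert G (\<Gamma> - {H}) \<subseteq> F"
    using B(1,2) GF by auto
  ultimately show ?thesis
    unfolding basis_def by (intro conjI ballI)
qed

lemma insert_Un_Diff_replace:
  "h \<notin> Z \<Longrightarrow> insert k (A - B \<union> Z - {h}) = A - insert h B \<union> insert k Z"
  by blast

text \<open>Replace the elements one by one; \<open>Y\<close> collects those already treated. The
  class of \<open>H\<close> refers to the original \<open>\<Gamma>\<close>, and
  \<open>equivalent_over_restrict\<close> carries it over to the current mixed basis.\<close>

lemma basis_of_transversal:
  assumes \<Gamma>: "basis \<Gamma>" and f: "\<And>H. H \<in> \<Gamma> \<Longrightarrow> f H \<in> exchange_class \<Gamma> H"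
  shows "basis (f ` \<Gamma>)"
proof -
  have "basis (\<Gamma> - Y \<union> f ` Y)" if "finite Y" "Y \<subseteq> \<Gamma>" for Y
    using that
  proof (induction Y rule: finite_induct)
    case empty
    then show ?case using \<Gamma> by simp
  next
    case (insert H Y)
    let ?\<Gamma>' = "\<Gamma> - Y \<union> f ` Y" and ?a = "apex H"
    have H: "H \<in> ?\<Gamma>'" using insert by auto
    have \<Gamma>': "basis ?\<Gamma>'" using insert by auto
    have fH: "f H \<in> F" "apex (f H) = ?a" "equivalent_over (off_apex \<Gamma> ?a) (f H) H"
      using f[of H] insert by (auto simp: exchange_class_def)
    have "equivalent_over (off_apex ?\<Gamma>' ?a) (f H) H"
    proof (rule equivalent_over_restrict[OF \<Gamma>' H fH(1,2)])
      show "equivalent_over (off_apex ?\<Gamma>' ?a \<union> off_apex \<Gamma> ?a) (f H) H"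
        using fH(3) by (auto simp: equivalent_over_def)
    qed (use basisD(1,2)[OF \<Gamma>] in \<open>auto simp: off_apex_def\<close>)
    then have "f H \<in> exchange_class ?\<Gamma>' H"
      using fH by (auto simp: exchange_class_def)
    then have "basis (insert (f H) (?\<Gamma>' - {H}))"
      by (rule basis_replace[OF \<Gamma>' H])
    \<comment> \<open>Otherwise removing \<open>H\<close> would also delete the replacement of an
      earlier element. Disjointness of the classes excludes this.\<close>
    moreover have "H \<notin> f ` Y"
    proof
      assume "H \<in> f ` Y"
      then obtain G where G: "G \<in> Y" "H = f G" by auto
      then have "H \<in> exchange_class \<Gamma> G" using f insert by auto
      moreover have "H \<in> exchange_class \<Gamma> H"
        using insert basisD(2)[OF \<Gamma>] by (auto simp: exchange_class_def equivalent_over_def)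
      ultimately have "G = H"
        using exchange_classes_disjoint[OF \<Gamma>, of H G H] insert G by auto
      with G(1) insert.hyps(2) show False by simp
    qed
    then have "insert (f H) (?\<Gamma>' - {H}) = \<Gamma> - insert H Y \<union> f ` insert H Y"
      unfolding image_insert by (rule insert_Un_Diff_replace)
    ultimately show ?case by simp
  qed
  from this[of \<Gamma>] show ?thesis using basisD(1)[OF \<Gamma>] by simp
qed

theorem basis_iff_one_from_each:
  assumes \<Gamma>: "basis \<Gamma>"
  shows "basis \<Gamma>' \<longleftrightarrow> one_from_each (apex ` \<Gamma>) (exchange_classes \<Gamma>) \<Gamma>'"
proof
  assume \<Gamma>': "basis \<Gamma>'"
  have "\<Gamma>' \<subseteq> (\<Union>a\<in>apex ` \<Gamma>. \<Union>(exchange_classes \<Gamma> a))"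
  proof
    fix G assume "G \<in> \<Gamma>'"
    then obtain H where "H \<in> \<Gamma>" "G \<in> exchange_class \<Gamma> H"
      by (rule basis_in_exchange_class[OF \<Gamma>' \<Gamma>])
    then show "G \<in> (\<Union>a\<in>apex ` \<Gamma>. \<Union>(exchange_classes \<Gamma> a))"
      by (auto simp: exchange_classes_def)
  qed
  moreover have "\<exists>!G. G \<in> \<Gamma>' \<and> G \<in> exchange_class \<Gamma> H" if H: "H \<in> \<Gamma>" for H
  proof -
    \<comment> \<open>This membership is relative to \<open>\<Gamma>'\<close>, whereas
      \<open>G\<close> is wanted in the class of \<open>H\<close> relative to
      \<open>\<Gamma>\<close>. So \<open>G\<close> is placed in the class of some \<open>H'\<close>
      in \<open>\<Gamma>\<close>, and the chain from \<open>H'\<close> via \<open>G\<close> to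
      \<open>H\<close> yields \<open>H' = H\<close>.\<close>
    obtain G where G: "G \<in> \<Gamma>'" "H \<in> exchange_class \<Gamma>' G"
      using basis_in_exchange_class[OF \<Gamma> \<Gamma>' H] .
    obtain H' where H': "H' \<in> \<Gamma>" "G \<in> exchange_class \<Gamma> H'"
      using basis_in_exchange_class[OF \<Gamma>' \<Gamma> G(1)] .
    have a: "apex G = apex H" "apex H' = apex H"
      using G H' by (auto simp: exchange_class_def)
    have "\<Inter>(off_apex \<Gamma>' (apex H)) \<inter> G \<subseteq> H" "\<Inter>(off_apex \<Gamma> (apex H)) \<inter> H' \<subseteq> G"
      using G(2) H'(2) a by (auto simp: exchange_class_def equivalent_over_def)
    then have "\<Inter>(off_apex \<Gamma> (apex H) \<union> off_apex \<Gamma>' (apex H)) \<inter> H' \<subseteq> H"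
      by (simp only: Inter_Un_distrib) blast
    then have "H' = H"
      using basisD(1,2)[OF \<Gamma>'] a
      by (intro basis_element_unique[OF \<Gamma> H H'(1), of "off_apex \<Gamma>' (apex H)"])
        (auto simp: off_apex_def)
    with H' G show ?thesis
      using basis_exchange_class_unique[OF \<Gamma>' \<Gamma>] by blast
  qed
  ultimately show "one_from_each (apex ` \<Gamma>) (exchange_classes \<Gamma>) \<Gamma>'"
    by (auto simp: one_from_each_def exchange_classes_def)
next
  assume one: "one_from_each (apex ` \<Gamma>) (exchange_classes \<Gamma>) \<Gamma>'"
  then have ex1: "\<exists>!G. G \<in> \<Gamma>' \<and> G \<in> exchange_class \<Gamma> H" if "H \<in> \<Gamma>" for H
    using that by (auto simp: one_from_each_def exchange_classes_def)
  define f where "f H = (THE G. G \<in> \<Gamma>' \<and> G \<in> exchange_class \<Gamma> H)" for H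
  have f: "f H \<in> \<Gamma>' \<and> f H \<in> exchange_class \<Gamma> H" if "H \<in> \<Gamma>" for H
    unfolding f_def by (rule theI'[OF ex1[OF that]])
  have "\<Gamma>' \<subseteq> f ` \<Gamma>"
  proof
    fix G assume "G \<in> \<Gamma>'"
    moreover from this obtain H where "H \<in> \<Gamma>" "G \<in> exchange_class \<Gamma> H"
      using one by (auto simp: one_from_each_def exchange_classes_def)
    ultimately show "G \<in> f ` \<Gamma>"
      using ex1 f by blast
  qed
  with f have "f ` \<Gamma> = \<Gamma>'" by blast
  with basis_of_transversal[OF \<Gamma>, of f] f show "basis \<Gamma>'" by auto
qed

lemma disjoint_exchange_classes:
  assumes "basis \<Gamma>"
  shows "disjoint (exchange_classes \<Gamma> a)"
proof (rule disjointI)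
  fix S T assume "S \<in> exchange_classes \<Gamma> a" "T \<in> exchange_classes \<Gamma> a" "S \<noteq> T"
  then show "S \<inter> T = {}"
    using exchange_classes_disjoint[OF assms] by (auto simp: exchange_classes_def)
qed

end

section \<open>Membership in half-spaces on the level of vectors\<close>

text \<open>With one attained maximum in place of two compared ones, membership depends only on
  whether \<open>I\<close> meets the set of coordinates maximising \<open>x - a\<close>, a set that
  is the same for all half-spaces with apex \<open>a\<close>.\<close>

definition in_half_space :: "real ^ 'n::finite \<Rightarrow> 'n set \<Rightarrow> ereal ^ 'n \<Rightarrow> bool" where
  "in_half_space a I x \<longleftrightarrow> (\<exists>i\<in>I. \<forall>j. x $ j - ereal (a $ j) \<le> x $ i - ereal (a $ i))"

lemma in_half_space_iff_MAX:
  fixes I :: "'n::finite set"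
  assumes "I \<noteq> {}" "I \<noteq> UNIV"
  shows "(MAX i\<in>I. x $ i - ereal (a $ i)) \<ge> (MAX j\<in>- I. x $ j - ereal (a $ j))
    \<longleftrightarrow> in_half_space a I x" (is "?L \<ge> ?R \<longleftrightarrow> _")
proof
  assume le: "?L \<ge> ?R"
  have "?L \<in> (\<lambda>i. x $ i - ereal (a $ i)) ` I"
    by (rule Max_in) (use assms in auto)
  then obtain i where i: "i \<in> I" "?L = x $ i - ereal (a $ i)" by auto
  have "x $ j - ereal (a $ j) \<le> ?L" for j
  proof (cases "j \<in> I")
    case False
    then have "x $ j - ereal (a $ j) \<le> ?R" by (intro Max_ge) auto
    with le show ?thesis by (rule order_trans[rotated])
  qed (auto intro!: Max_ge)
  with i show "in_half_space a I x"
    by (auto simp: in_half_space_def)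
next
  have ne: "- I \<noteq> {}" using assms by auto
  assume "in_half_space a I x"
  then obtain i where i: "i \<in> I" "\<And>j. x $ j - ereal (a $ j) \<le> x $ i - ereal (a $ i)"
    by (auto simp: in_half_space_def)
  have "?R \<le> x $ i - ereal (a $ i)"
    using i ne by (intro Max.boundedI) auto
  also have "\<dots> \<le> ?L" using i by (intro Max_ge) auto
  finally show "?L \<ge> ?R" .
qed

lemma point_eq_iff:
  assumes "x \<in> rmax_vectors" "y \<in> rmax_vectors"
  shows "point x = point y \<longleftrightarrow> proj_rel x y"
proof -
  have "proj_rel z z" if "z \<in> rmax_vectors" for z :: "ereal ^ 'a"
    using that by (auto simp: proj_rel_def intro!: exI[of _ 0])
  then show ?thesis
    using Quotient3_rel[OF Quotient3_tproj, of x y] assms by auto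
qed

lemma tproj_cases:
  obtains x where "x \<in> rmax_vectors" "p = point x"
proof
  show "p = point (rep_tproj p)"
    by (simp add: Quotient3_abs_rep[OF Quotient3_tproj])
  show "rep_tproj p \<in> rmax_vectors"
    using Quotient3_rep_reflp[OF Quotient3_tproj, of p] by (auto simp: proj_rel_def)
qed

lemma point_in_half_space:
  fixes I :: "'n::finite set"
  assumes x: "x \<in> rmax_vectors" and I: "I \<noteq> {}" "I \<noteq> UNIV"
  shows "point x \<in> half_space a I \<longleftrightarrow> in_half_space a I x"
proof
  assume "in_half_space a I x"
  then show "point x \<in> half_space a I"
    using x in_half_space_iff_MAX[OF I] by (auto simp: half_space_def)
next
  assume "point x \<in> half_space a I"
  then obtain y where y: "y \<in> rmax_vectors" "in_half_space a I y" "point x = point y"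
    using in_half_space_iff_MAX[OF I] by (auto simp: half_space_def)
  then obtain c :: real where c: "\<And>i. y $ i = ereal c + x $ i"
    using point_eq_iff[OF x y(1)] by (auto simp: proj_rel_def)
  have "(ereal c + u) - ereal v \<le> (ereal c + u') - ereal v' \<longleftrightarrow> u - ereal v \<le> u' - ereal v'"
    for u u' v v'
    by (cases u; cases u') auto
  with y(2) show "in_half_space a I x"
    by (simp add: in_half_space_def c)
qed

lemma real_vector_in_rmax_vectors: "(\<chi> i. ereal (a $ i)) \<in> rmax_vectors"
  by (auto simp: rmax_vectors_def)

lemma real_point_eq_iff: "real_point a = real_point b \<longleftrightarrow> (\<exists>c. \<forall>i. b $ i = c + a $ i)"
  unfolding real_point_def
  by (subst point_eq_iff) (auto simp: proj_rel_def real_vector_in_rmax_vectors)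

lemma real_point_in_half_space:
  assumes "I \<noteq> {}" "I \<noteq> UNIV"
  shows "real_point x \<in> half_space a I \<longleftrightarrow> (\<exists>i\<in>I. \<forall>j. x $ j - a $ j \<le> x $ i - a $ i)"
  unfolding real_point_def
  by (subst point_in_half_space[OF real_vector_in_rmax_vectors assms]) (simp add: in_half_space_def)

lemma half_space_cong_apex:
  fixes I :: "'n::finite set"
  assumes "real_point a = real_point b" and I: "I \<noteq> {}" "I \<noteq> UNIV"
  shows "half_space a I = half_space b I"
proof -
  obtain c :: real where c: "\<And>i. b $ i = c + a $ i"
    using assms(1) by (auto simp: real_point_eq_iff)
  have "u - ereal (c + v) \<le> u' - ereal (c + v') \<longleftrightarrow> u - ereal v \<le> u' - ereal v'" for u u' v v'
    by (cases u; cases u') auto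
  then have "in_half_space a I = in_half_space b I"
    by (simp add: in_half_space_def c fun_eq_iff)
  then have "p \<in> half_space a I \<longleftrightarrow> p \<in> half_space b I" for p
    by (cases p rule: tproj_cases) (simp add: point_in_half_space I)
  then show ?thesis by blast
qed

text \<open>Fixes one representative of the apex, so that all half-spaces sharing it differ only in
  their sectors.\<close>

lemma half_spaces_with_apex_cases:
  assumes "H \<in> half_spaces_with_apex (real_point a)"
  obtains I where "H = half_space a I" "I \<noteq> {}" "I \<noteq> UNIV"
proof -
  obtain b I where "H = half_space b I" "real_point b = real_point a" "I \<noteq> {}" "I \<noteq> UNIV"
    using assms unfolding half_spaces_with_apex_def by blast
  with that half_space_cong_apex show ?thesis by metis
qed

lemma apex_in_half_space:
  assumes "I \<noteq> {}" "I \<noteq> UNIV"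
  shows "real_point a \<in> half_space a I"
  using assms by (auto simp: real_point_in_half_space)

lemma half_space_neq_UNIV:
  assumes "I \<noteq> {}" "I \<noteq> UNIV"
  shows "half_space a I \<noteq> UNIV"
proof -
  obtain k where "k \<notin> I" using assms by auto
  \<comment> \<open>Raising the apex in a single coordinate outside \<open>I\<close> makes that
    coordinate the only maximiser.\<close>
  then have "real_point (\<chi> i. a $ i + (if i = k then 1 else 0)) \<notin> half_space a I"
    using assms by (auto simp: real_point_in_half_space intro!: exI[of _ k])
  then show ?thesis by auto
qed

section \<open>Tropical convexity\<close>

text \<open>The asymmetry is deliberate: \<open>y\<close> may have entries
  \<open>-\<infinity>\<close>, while the real \<open>x\<close> keeps the combination real. This
  allows arbitrary points to be replaced by real ones.\<close>

definition tropically_convex :: "'n::finite tproj set \<Rightarrow> bool" where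
  "tropically_convex D \<longleftrightarrow> (\<forall>x y z c. real_point x \<in> D \<longrightarrow> y \<in> rmax_vectors \<longrightarrow> point y \<in> D \<longrightarrow>
     (\<forall>i. ereal (z $ i) = max (ereal (x $ i)) (ereal c + y $ i)) \<longrightarrow> real_point z \<in> D)"

lemma tropically_convexD:
  assumes "tropically_convex D" "real_point x \<in> D" "real_point y \<in> D"
  shows "real_point (\<chi> i. max (x $ i) (c + y $ i)) \<in> D"
proof -
  have "\<forall>i. ereal ((\<chi> i. max (x $ i) (c + y $ i)) $ i)
      = max (ereal (x $ i)) (ereal c + (\<chi> i. ereal (y $ i)) $ i)"
    by simp
  with assms show ?thesis
    unfolding tropically_convex_def real_point_def using real_vector_in_rmax_vectors by blast
qed

lemma tropically_convex_Inter:
  "(\<And>H. H \<in> \<Delta> \<Longrightarrow> tropically_convex H) \<Longrightarrow> tropically_convex (\<Inter>\<Delta>)"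
  unfolding tropically_convex_def by (meson Inter_iff)

lemma ereal_eq_max_iff:
  assumes "v \<noteq> \<infinity>"
  shows "ereal z = max (ereal x) (ereal c + v) \<longleftrightarrow>
    x \<le> z \<and> v \<le> ereal (z - c) \<and> (z = x \<or> v = ereal (z - c))"
  using assms by (cases v) (auto simp: max_def)

text \<open>Let \<open>i\<close> and \<open>k\<close> in \<open>I\<close> maximise
  \<open>x - a\<close> and \<open>y - a\<close>. If no coordinate of \<open>z - a\<close> exceeds
  the maximum of \<open>x - a\<close>, then \<open>i\<close> maximises \<open>z - a\<close>;
  otherwise an exceeding coordinate stems from \<open>y\<close>, and \<open>k\<close> does.\<close>

lemma tropically_convex_half_space:
  fixes I :: "'n::finite set"
  assumes I: "I \<noteq> {}" "I \<noteq> UNIV"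
  shows "tropically_convex (half_space a I)"
  unfolding tropically_convex_def
proof (intro allI impI)
  fix x z :: "real ^ 'n" and y c
  assume x: "real_point x \<in> half_space a I" and y: "y \<in> rmax_vectors" "point y \<in> half_space a I"
    and z: "\<forall>i. ereal (z $ i) = max (ereal (x $ i)) (ereal c + y $ i)"
  have "y $ i \<noteq> \<infinity>" for i using y(1) by (auto simp: rmax_vectors_def)
  then have zx: "x $ i \<le> z $ i" and zy: "y $ i \<le> ereal (z $ i - c)"
    and zor: "z $ i = x $ i \<or> y $ i = ereal (z $ i - c)" for i
    using z ereal_eq_max_iff by blast+
  obtain i where i: "i \<in> I" "\<And>j. x $ j - a $ j \<le> x $ i - a $ i"
    using x by (auto simp: real_point_in_half_space I)
  obtain k where k: "k \<in> I" "\<And>j. y $ j - ereal (a $ j) \<le> y $ k - ereal (a $ k)"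
    using y by (auto simp: point_in_half_space I in_half_space_def)
  show "real_point z \<in> half_space a I"
  proof (cases "\<forall>j. z $ j - a $ j \<le> x $ i - a $ i")
    case True
    then have "z $ j - a $ j \<le> z $ i - a $ i" for j
      using zx[of i] by (meson diff_right_mono order_trans)
    with i(1) show ?thesis by (auto simp: real_point_in_half_space I)
  next
    case False
    then obtain l where l: "z $ l - a $ l > x $ i - a $ i" by (auto simp: not_le)
    with zx i have "z $ l \<noteq> x $ l" by (metis not_le)
    with zor have yl: "y $ l = ereal (z $ l - c)" by blast
    obtain w where w: "y $ k = ereal w" "z $ l - c - a $ l \<le> w - a $ k" "w \<le> z $ k - c"
      using k(2)[of l] zy[of k] yl by (cases "y $ k") auto
    have "z $ j - a $ j \<le> z $ k - a $ k" for j
      using zor[of j]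
    proof
      assume "z $ j = x $ j"
      then show ?thesis using i(2)[of j] l w by linarith
    next
      assume "y $ j = ereal (z $ j - c)"
      then show ?thesis using k(2)[of j] w by simp
    qed
    with k(1) show ?thesis by (auto simp: real_point_in_half_space I)
  qed
qed

section \<open>Real witnesses and their sums\<close>

lemma obtain_maximum:
  fixes f :: "'n::finite \<Rightarrow> 'a::linorder"
  obtains k where "\<And>i. f i \<le> f k"
proof -
  have "Max (range f) \<in> range f" by (rule Max_in) auto
  then obtain k where "Max (range f) = f k" by (rule imageE)
  with that show ?thesis by (metis Max_ge finite finite_imageI rangeI)
qed

text \<open>Adding a large multiple of \<open>p\<close> to \<open>a\<close> yields a real point with
  the same maximising coordinates relative to \<open>a\<close>.\<close>

lemma real_point_same_half_spaces:
  fixes a :: "real ^ 'n::finite"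
  assumes D: "tropically_convex D" "real_point a \<in> D" and p: "p \<in> D"
  obtains z where "real_point z \<in> D"
    "\<And>I. I \<noteq> {} \<Longrightarrow> I \<noteq> UNIV \<Longrightarrow> real_point z \<in> half_space a I \<longleftrightarrow> p \<in> half_space a I"
proof -
  obtain x where x: "x \<in> rmax_vectors" "p = point x" by (rule tproj_cases)
  have fin: "x $ i \<noteq> \<infinity>" for i using x(1) by (auto simp: rmax_vectors_def)
  obtain k where k: "\<And>i. x $ i - ereal (a $ i) \<le> x $ k - ereal (a $ k)"
    using obtain_maximum[of "\<lambda>i. x $ i - ereal (a $ i)"] by blast
  obtain l where "x $ l \<noteq> - \<infinity>" using x(1) by (auto simp: rmax_vectors_def)
  with k[of l] fin[of l] fin[of k] obtain w where w: "x $ k = ereal w"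
    by (cases "x $ k"; cases "x $ l") auto
  \<comment> \<open>This scales the maximum of \<open>x - a\<close> to 1, strictly above the 0 that
    \<open>a\<close> itself contributes in every coordinate.\<close>
  define c where "c = 1 - (w - a $ k)"
  define z where "z = (\<chi> i. real_of_ereal (max (ereal (a $ i)) (ereal c + x $ i)))"
  have z: "ereal (z $ i) = max (ereal (a $ i)) (ereal c + x $ i)" for i
    using fin[of i] by (cases "x $ i") (auto simp: z_def max_def)
  have "real_point z \<in> D"
    using D p x z unfolding tropically_convex_def by blast
  moreover have "(\<forall>j. z $ j - a $ j \<le> z $ i - a $ i) \<longleftrightarrow>
      (\<forall>j. x $ j - ereal (a $ j) \<le> x $ i - ereal (a $ i))" for i
  proof -
    have zk: "z $ k - a $ k = 1"
      using z[of k] w by (auto simp: c_def max_def split: if_splits)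
    have le: "z $ j - a $ j \<le> 1" for j
      using z[of j] k[of j] w fin[of j] by (cases "x $ j") (auto simp: c_def max_def split: if_splits)
    have "(\<forall>j. z $ j - a $ j \<le> z $ i - a $ i) \<longleftrightarrow> z $ i - a $ i = 1"
      using le zk by (metis order_antisym)
    also have "\<dots> \<longleftrightarrow> x $ i = ereal (w - a $ k + a $ i)"
      using z[of i] fin[of i] by (cases "x $ i") (auto simp: c_def max_def split: if_splits)
    also have "\<dots> \<longleftrightarrow> x $ k - ereal (a $ k) \<le> x $ i - ereal (a $ i)"
      using k[of i] w fin[of i] by (cases "x $ i") auto
    also have "\<dots> \<longleftrightarrow> (\<forall>j. x $ j - ereal (a $ j) \<le> x $ i - ereal (a $ i))"
      using k by (meson order_trans)
    finally show ?thesis .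
  qed
  ultimately show ?thesis
    using that x by (simp add: real_point_in_half_space point_in_half_space in_half_space_def)
qed

lemma real_point_union_half_spaces:
  fixes a :: "real ^ 'n::finite"
  assumes D: "tropically_convex D" and x: "real_point x \<in> D" and y: "real_point y \<in> D"
  obtains z where "real_point z \<in> D"
    "\<And>I. I \<noteq> {} \<Longrightarrow> I \<noteq> UNIV \<Longrightarrow>
      real_point z \<in> half_space a I \<longleftrightarrow> real_point x \<in> half_space a I \<or> real_point y \<in> half_space a I"
proof -
  obtain k where k: "\<And>i. x $ i - a $ i \<le> x $ k - a $ k"
    using obtain_maximum[of "\<lambda>i. x $ i - a $ i"] by blast
  obtain l where l: "\<And>i. y $ i - a $ i \<le> y $ l - a $ l"
    using obtain_maximum[of "\<lambda>i. y $ i - a $ i"] by blast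
  \<comment> \<open>With the two maxima made equal, the maximising coordinates of the sum are the
    union of those of \<open>x\<close> and \<open>y\<close>.\<close>
  define c where "c = (x $ k - a $ k) - (y $ l - a $ l)"
  define z where "z = (\<chi> i. max (x $ i) (c + y $ i))"
  have le: "z $ j - a $ j \<le> x $ k - a $ k" for j
    using k[of j] l[of j] by (auto simp: z_def c_def)
  have zk: "z $ k - a $ k = x $ k - a $ k"
    using le[of k] by (auto simp: z_def)
  have "(\<forall>j. z $ j - a $ j \<le> z $ i - a $ i) \<longleftrightarrow>
      (\<forall>j. x $ j - a $ j \<le> x $ i - a $ i) \<or> (\<forall>j. y $ j - a $ j \<le> y $ i - a $ i)" for i
  proof -
    have "(\<forall>j. z $ j - a $ j \<le> z $ i - a $ i) \<longleftrightarrow> x $ k - a $ k \<le> z $ i - a $ i"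
      using le zk by (metis order_trans)
    also have "\<dots> \<longleftrightarrow> x $ k - a $ k \<le> x $ i - a $ i \<or> y $ l - a $ l \<le> y $ i - a $ i"
      by (auto simp: z_def c_def max_def)
    also have "\<dots> \<longleftrightarrow>
        (\<forall>j. x $ j - a $ j \<le> x $ i - a $ i) \<or> (\<forall>j. y $ j - a $ j \<le> y $ i - a $ i)"
      using k l by (meson order_trans)
    finally show ?thesis .
  qed
  moreover have "real_point z \<in> D"
    unfolding z_def by (rule tropically_convexD[OF D x y])
  ultimately show ?thesis
    using that by (simp add: real_point_in_half_space bex_disj_distrib)
qed

text \<open>If every \<open>L\<close> fails on its own, each has a real witness in \<open>D\<close>
  outside \<open>G\<close>. Their scaled sum lies in a half-space with apex \<open>a\<close> exactly
  if some summand does, hence in every \<open>L\<close> but not in \<open>G\<close>.\<close>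

lemma half_space_single_premise:
  fixes a :: "real ^ 'n::finite"
  assumes D: "tropically_convex D" "real_point a \<in> D"
    and \<Lambda>: "finite \<Lambda>" "\<Lambda> \<noteq> {}" "\<Lambda> \<subseteq> half_spaces_with_apex (real_point a)"
    and G: "G \<in> half_spaces_with_apex (real_point a)"
    and imp: "D \<inter> \<Inter>\<Lambda> \<subseteq> G"
  shows "\<exists>L\<in>\<Lambda>. D \<inter> L \<subseteq> G"
proof (rule ccontr)
  assume "\<not> ?thesis"
  then have not: "\<not> D \<inter> L \<subseteq> G" if "L \<in> \<Lambda>" for L using that by blast
  obtain J where J: "G = half_space a J" "J \<noteq> {}" "J \<noteq> UNIV"
    using G by (rule half_spaces_with_apex_cases)
  have single: "\<exists>z. real_point z \<in> D \<inter> L \<and> real_point z \<notin> G" if "L \<in> \<Lambda>" for L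
  proof -
    obtain p where p: "p \<in> D" "p \<in> L" "p \<notin> G" using not \<open>L \<in> \<Lambda>\<close> by blast
    obtain I where "L = half_space a I" "I \<noteq> {}" "I \<noteq> UNIV"
      using half_spaces_with_apex_cases \<Lambda>(3) \<open>L \<in> \<Lambda>\<close> by (metis subsetD)
    with real_point_same_half_spaces[OF D p(1)] J p show ?thesis
      by (metis IntI)
  qed
  have "\<exists>z. real_point z \<in> D \<inter> \<Inter>\<Lambda> \<and> real_point z \<notin> G"
    using \<Lambda>(1,2,3) single
  proof (induction \<Lambda> rule: finite_ne_induct)
    case (singleton L)
    then show ?case by simp
  next
    case (insert L \<Lambda>)
    obtain x where x: "real_point x \<in> D" "real_point x \<in> L" "real_point x \<notin> G"
      using insert.prems(2)[of L] by auto
    obtain y where y: "real_point y \<in> D" "real_point y \<in> \<Inter>\<Lambda>" "real_point y \<notin> G"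
      using insert.IH insert.prems by auto
    obtain z where z: "real_point z \<in> D" "\<And>I. I \<noteq> {} \<Longrightarrow> I \<noteq> UNIV \<Longrightarrow>
        real_point z \<in> half_space a I \<longleftrightarrow> real_point x \<in> half_space a I \<or> real_point y \<in> half_space a I"
      using real_point_union_half_spaces[OF D(1) x(1) y(1), of a] by blast
    have "real_point z \<in> K" if K: "K \<in> insert L \<Lambda>" for K
    proof -
      obtain I where "K = half_space a I" "I \<noteq> {}" "I \<noteq> UNIV"
        using half_spaces_with_apex_cases insert.prems(1) K by (metis subsetD)
      with z(2)[of I] x y K show ?thesis by blast
    qed
    moreover have "real_point z \<notin> G"
      using z(2) J x y by blast
    ultimately show ?case using z(1) by blast
  qed
  with imp show False by blast
qed

section \<open>Anti-exchange for half-spaces with different apices\<close>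

text \<open>A point \<open>y\<close> on the segment from \<open>a\<close> to \<open>x\<close>,
  arbitrarily close to \<open>a\<close>, is already outside \<open>half_space a I\<close>, hence
  outside \<open>half_space b J\<close>. Since \<open>a\<close> is inside the latter, the scaled
  \<open>x\<close> must exceed the maximum of \<open>a - b\<close> somewhere relative to
  \<open>b\<close>.\<close>

lemma segment_bound:
  fixes a b x :: "real ^ 'n::finite"
  assumes D: "tropically_convex D" "real_point a \<in> D" "real_point x \<in> D"
    and I: "I \<noteq> {}" "I \<noteq> UNIV" and J: "J \<noteq> {}" "J \<noteq> UNIV"
    and sub: "D \<inter> half_space b J \<subseteq> half_space a I"
    and x: "real_point x \<notin> half_space a I" and a: "real_point a \<in> half_space b J"
    and k: "\<And>i. x $ i - a $ i \<le> x $ k - a $ k" and l: "\<And>i. x $ i - b $ i \<le> x $ l - b $ l"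
  shows "a $ i - b $ i \<le> (x $ l - b $ l) - (x $ k - a $ k)"
proof (rule field_le_epsilon)
  fix e :: real assume e: "e > 0"
  \<comment> \<open>The maximum of \<open>y - a\<close> becomes \<open>e > 0\<close>, so it is
    attained only where \<open>x - a\<close> is maximal, which never happens in
    \<open>I\<close>.\<close>
  define c where "c = e - (x $ k - a $ k)"
  define y where "y = (\<chi> i. max (a $ i) (c + x $ i))"
  have y: "y $ i = max (a $ i) (c + x $ i)" for i by (simp add: y_def)
  have "real_point y \<in> D"
    unfolding y_def by (rule tropically_convexD[OF D])
  moreover have "real_point y \<notin> half_space a I"
  proof
    assume "real_point y \<in> half_space a I"
    then obtain i where i: "i \<in> I" "y $ k - a $ k \<le> y $ i - a $ i"
      by (auto simp: real_point_in_half_space I)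
    with e have "x $ k - a $ k \<le> x $ i - a $ i"
      unfolding y c_def by linarith
    with i k have "\<exists>i\<in>I. \<forall>j. x $ j - a $ j \<le> x $ i - a $ i"
      by (meson order_trans)
    with x show False by (simp add: real_point_in_half_space I)
  qed
  ultimately have ny: "real_point y \<notin> half_space b J" using sub by blast
  obtain m where m: "m \<in> J" "\<And>j. a $ j - b $ j \<le> a $ m - b $ m"
    using a by (auto simp: real_point_in_half_space J)
  obtain j where j: "y $ j - b $ j > y $ m - b $ m"
    using ny m(1) by (auto simp: real_point_in_half_space J not_le)
  \<comment> \<open>The excess at \<open>j\<close> cannot come from \<open>a\<close>, because
    \<open>m\<close> maximises \<open>a - b\<close>.\<close>
  have "a $ m - b $ m < c + x $ j - b $ j"
    using j m(2)[of j] unfolding y by linarith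
  then show "a $ i - b $ i \<le> (x $ l - b $ l) - (x $ k - a $ k) + e"
    using m(2)[of i] l[of j] unfolding c_def by linarith
qed

text \<open>The segment from \<open>a\<close> to a point outside the half-spaces leaves both of them immediately, as does
  the one from \<open>b\<close>; comparing the two exit times shows that the Hilbert distance between the
  apices \<open>a\<close> and \<open>b\<close> is at most \<open>0\<close>.\<close>

lemma half_space_anti_exchange:
  fixes a b :: "real ^ 'n::finite"
  assumes D: "tropically_convex D" "real_point a \<in> D" "real_point b \<in> D"
    and H: "H \<in> half_spaces_with_apex (real_point a)"
    and G: "G \<in> half_spaces_with_apex (real_point b)"
    and "\<not> D \<subseteq> H" and GH: "D \<inter> G \<subseteq> H" and HG: "D \<inter> H \<subseteq> G"
  shows "real_point a = real_point b"
proof -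
  obtain I where I: "H = half_space a I" "I \<noteq> {}" "I \<noteq> UNIV"
    using H by (rule half_spaces_with_apex_cases)
  obtain J where J: "G = half_space b J" "J \<noteq> {}" "J \<noteq> UNIV"
    using G by (rule half_spaces_with_apex_cases)
  obtain p where "p \<in> D" "p \<notin> H" using assms by blast
  with real_point_same_half_spaces[OF D(1,2)] I obtain x
    where x: "real_point x \<in> D" "real_point x \<notin> H" by metis
  have xG: "real_point x \<notin> G" using x GH by blast
  have aG: "real_point a \<in> G" and bH: "real_point b \<in> H"
    using apex_in_half_space I J D GH HG by blast+
  obtain k where k: "\<And>i. x $ i - a $ i \<le> x $ k - a $ k"
    using obtain_maximum[of "\<lambda>i. x $ i - a $ i"] by blast
  obtain l where l: "\<And>i. x $ i - b $ i \<le> x $ l - b $ l"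
    using obtain_maximum[of "\<lambda>i. x $ i - b $ i"] by blast
  have 1: "a $ i - b $ i \<le> (x $ l - b $ l) - (x $ k - a $ k)" for i
    using segment_bound[OF D(1,2) x(1) I(2,3) J(2,3) _ _ _ k l] x aG GH I J by simp
  have 2: "b $ i - a $ i \<le> (x $ k - a $ k) - (x $ l - b $ l)" for i
    using segment_bound[OF D(1,3) x(1) J(2,3) I(2,3) _ _ _ l k] xG bH HG I J by simp
  have "b $ i = ((x $ k - a $ k) - (x $ l - b $ l)) + a $ i" for i
    using 1[of i] 2[of i] by linarith
  then show ?thesis unfolding real_point_eq_iff by blast
qed

section \<open>Supporting half-spaces as an instance of the locale\<close>

lemma half_spaces_with_apexD:
  assumes "H \<in> half_spaces_with_apex \<alpha>"
  shows "\<exists>a. \<alpha> = real_point a" "tropically_convex H" "H \<noteq> UNIV" "\<alpha> \<in> H"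
proof -
  obtain a I where "H = half_space a I" "\<alpha> = real_point a" "I \<noteq> {}" "I \<noteq> UNIV"
    using assms unfolding half_spaces_with_apex_def by blast
  then show "\<exists>a. \<alpha> = real_point a" "tropically_convex H" "H \<noteq> UNIV" "\<alpha> \<in> H"
    by (auto simp: tropically_convex_half_space half_space_neq_UNIV apex_in_half_space)
qed

text \<open>Anti-exchange over the whole space, with \<open>H\<close> exchanged for itself; a point
  outside \<open>H\<close> exists since half-spaces are proper.\<close>

lemma half_spaces_with_apex_unique:
  assumes H: "H \<in> half_spaces_with_apex \<alpha>" "H \<in> half_spaces_with_apex \<beta>"
  shows "\<alpha> = \<beta>"
proof -
  obtain a b where ab: "\<alpha> = real_point a" "\<beta> = real_point b"
    using half_spaces_with_apexD(1)[OF H(1)] half_spaces_with_apexD(1)[OF H(2)] by blast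
  show ?thesis
    unfolding ab
    by (rule half_space_anti_exchange[of UNIV _ _ H H])
      (use H ab half_spaces_with_apexD(3)[OF H(1)] in \<open>auto simp: tropically_convex_def\<close>)
qed

definition apex :: "'n::finite tproj set \<Rightarrow> 'n tproj" where
  "apex H = (THE \<alpha>. H \<in> half_spaces_with_apex \<alpha>)"

lemma apex_eq: "H \<in> half_spaces_with_apex \<alpha> \<Longrightarrow> apex H = \<alpha>"
  unfolding apex_def by (rule the_equality, assumption, rule half_spaces_with_apex_unique)

text \<open>Apices in \<open>C\<close> lie in every intersection of these half-spaces, which is what
  the lemmas on exchange and single premises demand of \<open>D\<close>.\<close>

definition supporting_half_spaces :: "'n::finite tproj set \<Rightarrow> 'n tproj set set" where
  "supporting_half_spaces C = {H. C \<subseteq> H \<and> (\<exists>\<alpha>\<in>C. H \<in> half_spaces_with_apex \<alpha>)}"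

lemma supporting_half_spacesD:
  assumes "H \<in> supporting_half_spaces C"
  shows "C \<subseteq> H" "apex H \<in> C" "H \<in> half_spaces_with_apex (apex H)"
proof -
  obtain \<alpha> where "C \<subseteq> H" "\<alpha> \<in> C" "H \<in> half_spaces_with_apex \<alpha>"
    using assms unfolding supporting_half_spaces_def by blast
  moreover from this have "apex H = \<alpha>" by (intro apex_eq)
  ultimately show "C \<subseteq> H" "apex H \<in> C" "H \<in> half_spaces_with_apex (apex H)"
    by simp_all
qed

lemma tropically_convex_Inter_supporting:
  assumes "\<Delta> \<subseteq> supporting_half_spaces C"
  shows "tropically_convex (\<Inter>\<Delta>)" "C \<subseteq> \<Inter>\<Delta>"
proof -
  show "C \<subseteq> \<Inter>\<Delta>"
    using assms supporting_half_spacesD(1) by blast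
  show "tropically_convex (\<Inter>\<Delta>)"
  proof (rule tropically_convex_Inter)
    fix H assume "H \<in> \<Delta>"
    with assms have "H \<in> supporting_half_spaces C" by blast
    then show "tropically_convex H"
      by (rule half_spaces_with_apexD(2)[OF supporting_half_spacesD(3)])
  qed
qed

lemma partial_anti_exchange_half_spaces:
  "partial_anti_exchange (supporting_half_spaces C) apex"
proof
  fix \<Delta> H G
  assume \<Delta>: "\<Delta> \<subseteq> supporting_half_spaces C" and H: "H \<in> supporting_half_spaces C"
    and G: "G \<in> supporting_half_spaces C" and imp: "\<not> \<Inter>\<Delta> \<subseteq> H"
    "\<Inter>(insert G \<Delta>) \<subseteq> H" "\<Inter>(insert H \<Delta>) \<subseteq> G"
  note H = supporting_half_spacesD[OF H] and G = supporting_half_spacesD[OF G]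
  obtain a b where ab: "apex H = real_point a" "apex G = real_point b"
    using half_spaces_with_apexD(1)[OF H(3)] half_spaces_with_apexD(1)[OF G(3)] by blast
  show "apex H = apex G"
    unfolding ab
    by (rule half_space_anti_exchange[OF tropically_convex_Inter_supporting(1)[OF \<Delta>] _ _ _ _ imp(1)])
      (use H G ab imp tropically_convex_Inter_supporting(2)[OF \<Delta>] in auto)
next
  fix \<Delta> \<Lambda> G
  assume \<Delta>: "\<Delta> \<subseteq> supporting_half_spaces C" and \<Lambda>: "\<Lambda> \<subseteq> supporting_half_spaces C" "finite \<Lambda>" "\<Lambda> \<noteq> {}"
    and G: "G \<in> supporting_half_spaces C" and ap: "\<And>L. L \<in> \<Lambda> \<Longrightarrow> apex L = apex G"
    and imp: "\<Inter>(\<Delta> \<union> \<Lambda>) \<subseteq> G"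
  note G = supporting_half_spacesD[OF G]
  obtain a where a: "apex G = real_point a"
    using half_spaces_with_apexD(1)[OF G(3)] by blast
  have "\<exists>L\<in>\<Lambda>. \<Inter>\<Delta> \<inter> L \<subseteq> G"
  proof (rule half_space_single_premise[OF tropically_convex_Inter_supporting(1)[OF \<Delta>] _ \<Lambda>(2,3)])
    show "\<Lambda> \<subseteq> half_spaces_with_apex (real_point a)"
      using \<Lambda>(1) ap supporting_half_spacesD(3) a by (metis subsetD subsetI)
  qed (use G a imp tropically_convex_Inter_supporting(2)[OF \<Delta>] in \<open>auto simp: Inter_Un_distrib\<close>)
  then show "\<exists>L\<in>\<Lambda>. \<Inter>(insert L \<Delta>) \<subseteq> G"
    by (simp add: Int_commute)
qed

section \<open>Representations as bases, and the theorem\<close>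

lemma real_polyhedral_cone_nonempty:
  fixes C :: "'n::finite tproj set"
  assumes "real_polyhedral_cone C"
  shows "C \<noteq> {}"
proof -
  obtain p and v :: "nat \<Rightarrow> real ^ 'n"
    where p: "p \<ge> 1" and C: "C = point ` (tropical_cone p v \<inter> rmax_vectors)"
    using assms by (auto simp: real_polyhedral_cone_def)
  \<comment> \<open>All coefficients are the tropical unit 0, so the combination of the real
    generators is real.\<close>
  define x where "x = (\<chi> i. MAX r\<in>{1..p}. (0::ereal) + ereal (v r $ i))"
  have "x \<in> tropical_cone p v"
    unfolding tropical_cone_def x_def by (intro CollectI exI[of _ "\<lambda>_. 0"]) auto
  moreover have "x $ i \<in> (\<lambda>r. 0 + ereal (v r $ i)) ` {1..p}" for i
    unfolding x_def vec_lambda_beta by (rule Max_in) (use p in auto)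
  then have "x $ i \<noteq> \<infinity> \<and> x $ i \<noteq> - \<infinity>" for i
    by (metis (no_types, lifting) MInfty_neq_ereal(1) PInfty_neq_ereal(1) add_0 imageE)
  then have "x \<in> rmax_vectors" by (auto simp: rmax_vectors_def)
  ultimately show ?thesis using C by auto
qed

text \<open>The given \<open>\<Gamma>\<close> exhibits \<open>C\<close> as an intersection of
  supporting half-spaces. Hence implying all of these amounts to having an intersection inside
  \<open>C\<close>.\<close>

lemma nonredundant_iff_basis:
  assumes \<Gamma>: "nonredundant_external_representation C \<Gamma>" "\<Gamma> \<subseteq> (\<Union>\<alpha>\<in>C. half_spaces_with_apex \<alpha>)"
    and \<Gamma>': "finite \<Gamma>'" "\<Gamma>' \<subseteq> (\<Union>\<alpha>\<in>C. half_spaces_with_apex \<alpha>)"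
  shows "nonredundant_external_representation C \<Gamma>' \<longleftrightarrow>
    partial_anti_exchange.basis (supporting_half_spaces C) \<Gamma>'"
proof -
  interpret partial_anti_exchange "supporting_half_spaces C" apex
    by (rule partial_anti_exchange_half_spaces)
  have sub: "\<Gamma> \<subseteq> supporting_half_spaces C" and C: "\<Inter>\<Gamma> = C"
    using \<Gamma> by (auto simp: nonredundant_external_representation_def supporting_half_spaces_def)
  have hs: "\<Gamma>' \<subseteq> half_spaces"
    using \<Gamma>'(2) unfolding half_spaces_def half_spaces_with_apex_def by blast
  have sub': "\<Gamma>' \<subseteq> supporting_half_spaces C \<longleftrightarrow> (\<forall>H\<in>\<Gamma>'. C \<subseteq> H)"
    using \<Gamma>'(2) by (auto simp: supporting_half_spaces_def)
  have "\<Inter>\<Gamma>' = C \<longleftrightarrow> (\<forall>H\<in>supporting_half_spaces C. \<Inter>\<Gamma>' \<subseteq> H)" if "\<forall>H\<in>\<Gamma>'. C \<subseteq> H"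
  proof
    assume "\<forall>H\<in>supporting_half_spaces C. \<Inter>\<Gamma>' \<subseteq> H"
    then have "\<Inter>\<Gamma>' \<subseteq> \<Inter>\<Gamma>" using sub by blast
    with C that show "\<Inter>\<Gamma>' = C" by blast
  qed (use supporting_half_spacesD(1) in blast)
  then show ?thesis
    unfolding nonredundant_external_representation_def basis_def using \<Gamma>'(1) hs sub' by blast
qed

theorem theorem1:
  fixes C :: "'n::finite tproj set"
  assumes "real_polyhedral_cone C"
  shows "\<exists>(A :: 'n tproj set) (K :: 'n tproj \<Rightarrow> 'n tproj set set set).
    A \<subseteq> C \<and>
    (\<forall>a\<in>A. disjoint (K a) \<and> (\<forall>S\<in>K a. S \<subseteq> half_spaces_with_apex a)) \<and>
    (\<forall>\<Gamma>. finite \<Gamma> \<and> \<Gamma> \<subseteq> (\<Union>\<alpha>\<in>C. half_spaces_with_apex \<alpha>) \<longrightarrow>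
      (nonredundant_external_representation C \<Gamma> \<longleftrightarrow> one_from_each A K \<Gamma>))"
proof (cases "\<exists>\<Gamma>. nonredundant_external_representation C \<Gamma> \<and>
    \<Gamma> \<subseteq> (\<Union>\<alpha>\<in>C. half_spaces_with_apex \<alpha>)")
  case True
  \<comment> \<open>Any one representation serves as a reference: its apices form \<open>A\<close>,
    its exchange classes the collections.\<close>
  then obtain \<Gamma> where \<Gamma>: "nonredundant_external_representation C \<Gamma>"
    "\<Gamma> \<subseteq> (\<Union>\<alpha>\<in>C. half_spaces_with_apex \<alpha>)" by blast
  interpret partial_anti_exchange "supporting_half_spaces C" apex
    by (rule partial_anti_exchange_half_spaces)
  have "finite \<Gamma>"
    using \<Gamma>(1) by (simp add: nonredundant_external_representation_def)
  with \<Gamma> have basis: "basis \<Gamma>"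
    using nonredundant_iff_basis[OF \<Gamma>] by blast
  show ?thesis
  proof (intro exI[of _ "apex ` \<Gamma>"] exI[of _ "exchange_classes \<Gamma>"] conjI ballI allI impI)
    show "apex ` \<Gamma> \<subseteq> C"
      using basisD(2)[OF basis] supporting_half_spacesD(2) by blast
    show "disjoint (exchange_classes \<Gamma> a)" for a
      by (rule disjoint_exchange_classes[OF basis])
    show "S \<subseteq> half_spaces_with_apex a" if "S \<in> exchange_classes \<Gamma> a" for S a
      using that supporting_half_spacesD(3)
      by (fastforce simp: exchange_classes_def exchange_class_def)
    show "nonredundant_external_representation C \<Gamma>' \<longleftrightarrow>
        one_from_each (apex ` \<Gamma>) (exchange_classes \<Gamma>) \<Gamma>'"
      if "finite \<Gamma>' \<and> \<Gamma>' \<subseteq> (\<Union>\<alpha>\<in>C. half_spaces_with_apex \<alpha>)" for \<Gamma>'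
      using nonredundant_iff_basis[OF \<Gamma>] basis_iff_one_from_each[OF basis] that by blast
  qed
next
  case False
  obtain \<alpha> where "\<alpha> \<in> C"
    using real_polyhedral_cone_nonempty[OF assms] by blast
  \<comment> \<open>No set has an element in the empty class, so this choice admits no \<open>\<Gamma>\<close> at all.\<close>
  moreover have "\<not> one_from_each {\<alpha>} (\<lambda>_. {{}}) \<Gamma>" for \<Gamma> :: "'n tproj set set"
    by (auto simp: one_from_each_def)
  ultimately show ?thesis
    using False by (intro exI[of _ "{\<alpha>}"] exI[of _ "\<lambda>_. {{}}"]) (auto simp: disjoint_def)
qed

end
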